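(* Let $(E,\|\cdot\|)$ be a real Banach space, $K\subset E$ a nonempty bounded closed convex set, and let $A:E\supset D(A)\to E$ be a densely defined linear operator such that $(\omega,\infty)\subset\rho(A)$ for some $\omega\in\mathbb{R}$. Let $(E_0,\|\cdot\|_0)$ be another Banach space and $K_0\subset E_0$ a closed convex set such that $D(A)\subset E_0\subset E$, $K_0\subset K$, and the identity embeddings $D(A)\hookrightarrow E_0$ (with $D(A)$ carrying the graph norm) and $j:E_0\hookrightarrow E$ are continuous. Let $\Phi:K_0\multimap E$ be an $H$-upper semicontinuous, bounded set-valued map with convex weakly compact values such that $$\Phi(u)\cap T_K(j(u))\neq\emptyset\quad\text{for all }u\in K_0.$$ Assume moreover that for all sufficiently small $h>0$ the resolvent $J_h=(I-hA)^{-1}$ satisfies $J_h(K)\subset K_0$ and $J_h:E\to E_0$ is compact. Then there is $u\in K_0\cap D(A)$ such that $0\in Au+\Phi(u)$.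
   Context: The graph norm on $D(A)$ is $\|u\|_A:=\|u\|+\|Au\|$. $\rho(A)$ is the resolvent set of $A$; for $h>0$ with $h\omega<1$, $J_h:=(I-hA)^{-1}:E\to E$ is well defined with values in $D(A)\subset E_0$. A map into $E_0$ is compact if it is continuous and maps bounded sets to relatively compact sets. The symbol $\multimap$ denotes a set-valued map. $\Phi:K_0\multimap E$ is $H$-upper semicontinuous if for each $x\in K_0$ and $\varepsilon>0$ there is $\delta>0$ such that $\Phi(y)\subset\{z\in E\mid \inf_{w\in\Phi(x)}\|z-w\|<\varepsilon\}$ whenever $y\in K_0$ and $\|y-x\|_0<\delta$. $\Phi$ is bounded if $\bigcup_{u\in K_0}\Phi(u)$ is a bounded subset of $E$. For a closed $K\subset E$ and $x\in K$, with $d_K(u):=\inf_{y\in K}\|y-u\|$, the contingent (Bouligand) cone is $T_K(x)=\{v\in E\mid \liminf_{h\to0^+}d_K(x+hv)/h=0\}$; for convex $K$ it equals the closure of $\bigcup_{h>0}h(K-x)$. *)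

theory Defs
  imports "HOL-Analysis.Analysis"
begin

text \<open>
  An unbounded operator is a pair of a domain \<open>D\<close> and a total function \<open>A\<close> whose values outside
  \<open>D\<close> are irrelevant.
\<close>

definition linear_operator_on :: "'a::real_vector set \<Rightarrow> ('a \<Rightarrow> 'b::real_vector) \<Rightarrow> bool" where
  "linear_operator_on D A \<longleftrightarrow> subspace D \<and>
     (\<forall>x\<in>D. \<forall>y\<in>D. A (x + y) = A x + A y) \<and> (\<forall>c. \<forall>x\<in>D. A (c *\<^sub>R x) = c *\<^sub>R A x)"

definition graph_norm :: "('a::real_normed_vector \<Rightarrow> 'b::real_normed_vector) \<Rightarrow> 'a \<Rightarrow> real" where
  "graph_norm A u = norm u + norm (A u)"

definition continuous_in_graph_norm ::
    "'a::real_normed_vector set \<Rightarrow> ('a \<Rightarrow> 'b::real_normed_vector) \<Rightarrow> ('a \<Rightarrow> 'c::real_normed_vector) \<Rightarrow> bool" where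
  "continuous_in_graph_norm D A f \<longleftrightarrow>
     (\<forall>u\<in>D. \<forall>\<epsilon>>0. \<exists>\<delta>>0. \<forall>v\<in>D. graph_norm A (v - u) < \<delta> \<longrightarrow> norm (f v - f u) < \<epsilon>)"

definition real_resolvent_set :: "'a::real_normed_vector set \<Rightarrow> ('a \<Rightarrow> 'a) \<Rightarrow> real set" where
  "real_resolvent_set D A = {\<mu>. bij_betw (\<lambda>u. \<mu> *\<^sub>R u - A u) D UNIV \<and>
     bounded_linear (inv_into D (\<lambda>u. \<mu> *\<^sub>R u - A u))}"

text \<open>\<open>(I - h A)\<inverse>\<close>, meaningful when \<open>I - h A\<close> is a bijection from \<open>D\<close> onto the space:\<close>

definition resolvent_op :: "'a::real_normed_vector set \<Rightarrow> ('a \<Rightarrow> 'a) \<Rightarrow> real \<Rightarrow> 'a \<Rightarrow> 'a" where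
  "resolvent_op D A h = inv_into D (\<lambda>u. u - h *\<^sub>R A u)"

text \<open>Compactness of a possibly nonlinear map:\<close>

definition compact_map :: "('a::metric_space \<Rightarrow> 'b::metric_space) \<Rightarrow> bool" where
  "compact_map f \<longleftrightarrow> continuous_on UNIV f \<and> (\<forall>B. bounded B \<longrightarrow> compact (closure (f ` B)))"

text \<open>
  The weak topology is the initial topology for all bounded linear functionals: the function space
  \<open>('a \<Rightarrow>\<^sub>L real) \<Rightarrow> real\<close> carries the topology of pointwise convergence.
\<close>

definition weak_topology :: "'a::real_normed_vector topology" where
  "weak_topology = pullback_topology UNIV (\<lambda>x (f :: 'a \<Rightarrow>\<^sub>L real). blinfun_apply f x) euclidean"

text \<open>
  Since \<open>infdist z {} = 0\<close>, the next two definitions are the intended ones only for nonempty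
  \<open>\<Phi> x\<close> (\<open>x \<in> K\<^sub>0\<close>) and nonempty \<open>K\<close>, respectively.
\<close>

definition H_usc_on :: "'b::real_normed_vector set \<Rightarrow> ('b \<Rightarrow> 'a::real_normed_vector set) \<Rightarrow> bool" where
  "H_usc_on K\<^sub>0 \<Phi> \<longleftrightarrow> (\<forall>x\<in>K\<^sub>0. \<forall>\<epsilon>>0. \<exists>\<delta>>0. \<forall>y\<in>K\<^sub>0.
     norm (y - x) < \<delta> \<longrightarrow> \<Phi> y \<subseteq> {z. infdist z (\<Phi> x) < \<epsilon>})"

definition contingent_cone :: "'a::real_normed_vector set \<Rightarrow> 'a \<Rightarrow> 'a set" where
  "contingent_cone K x =
     {v. Liminf (at_right 0) (\<lambda>h::real. ereal (infdist (x + h *\<^sub>R v) K / h)) = 0}"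

end

theory Submission
  imports Defs
begin

text \<open>
  The solution is found as a limit of fixed points of implicit Euler steps.

  Suppose first that \<open>\<Phi>\<close> is a single continuous map \<open>f\<close> for which \<open>j u + h f u\<close> stays in \<open>K\<close> for all \<open>u\<close>
  and some small \<open>h\<close>. Then \<open>u \<mapsto> J\<^sub>h (j u + h f u)\<close> maps the compact convex set \<open>closure (J\<^sub>h K)\<close> of \<open>K\<^sub>0\<close> into itself, so
  it has a fixed point by \<open>schauder_fixed_point\<close>, and \<open>u = J\<^sub>h (u + h f u)\<close> says precisely that \<open>A u + f u = 0\<close>. No limit
  \<open>h \<rightarrow> 0\<close> is involved.

  For a set-valued \<open>\<Phi>\<close>, the theorem \<open>tangent_graph_approximation\<close> supplies such a map \<open>f\<close> for each accuracy
  \<open>\<epsilon>\<close>: its graph over a prescribed compact set \<open>Q\<close> is \<open>\<epsilon>\<close>-close to that of \<open>\<Phi>\<close>, and \<open>f\<close> is bounded on \<open>K\<^sub>0\<close> by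
  the bound of \<open>\<Phi>\<close> plus \<open>\<epsilon>\<close>. It is enough to have closeness over \<open>Q\<close>, because the zeros of \<open>A + f\<close> satisfy an
  a priori estimate: both \<open>u\<close> and \<open>A u\<close> are bounded, and \<open>u = J\<^sub>h (u - h A u)\<close> with a fixed \<open>h\<close> places \<open>u\<close> in the
  image of a fixed ball under a compact map.

  As \<open>\<epsilon>\<close> tends to zero, the approximate solutions accumulate at some \<open>u\<close> in \<open>Q\<close>, and upper semicontinuity shows
  that \<open>u - J\<^sub>h u\<close> is a norm limit of points \<open>h J\<^sub>h w\<close> with \<open>w \<in> \<Phi> u\<close>. The image of the weakly compact set
  \<open>\<Phi> u\<close> under a bounded operator is norm closed (\<open>closed_image_weakly_compact\<close>), so
  \<open>u = J\<^sub>h (u + h w)\<close> for some \<open>w \<in> \<Phi> u\<close>, which means that \<open>A u + w = 0\<close>.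

  Two classical theorems are proved on the way. Schauder's theorem is reduced to the fixed-point property
  of the Hilbert cube, which follows from Kuhn's combinatorial lemma; the closedness of images
  rests on the separation of points by bounded functionals, obtained from minimal sublinear functionals.
\<close>

section \<open>The fixed-point property of the Hilbert cube\<close>

abbreviation hilbert_cube :: "(nat \<Rightarrow> real) set" where
  "hilbert_cube \<equiv> {t. \<forall>i. 0 \<le> t i \<and> t i \<le> 1}"

lemma tendsto_fun_iff:
  fixes f :: "nat \<Rightarrow> nat \<Rightarrow> real"
  shows "f \<longlonglongrightarrow> l \<longleftrightarrow> (\<forall>i. (\<lambda>k. f k i) \<longlonglongrightarrow> l i)"
  using limitin_componentwise[of "\<lambda>_. euclidean" "UNIV::nat set" f l sequentially]
  by (simp add: euclidean_product_topology)

lemma compact_hilbert_cube: "compact hilbert_cube"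
proof -
  have "hilbert_cube = PiE UNIV (\<lambda>_. {0..1})"
    by (auto simp: PiE_def Pi_def)
  then show ?thesis
    using compactin_PiE[of "\<lambda>_::nat. euclidean::real topology" UNIV "\<lambda>_. {0..1}"]
    by (simp add: euclidean_product_topology)
qed

text \<open>
  The idea is to apply Sperner-type labelling directly in the infinite-dimensional cube, with no
  fixed dimension: at stage \<open>n\<close> only the first \<open>n\<close> coordinates are discretised, with mesh
  \<open>1 / n\<close>, and the others are set to zero. Kuhn's lemma finds a cell \<open>q n\<close> which has, for every
  coordinate \<open>i < n\<close>, a vertex that \<open>T\<close> does not decrease in coordinate \<open>i\<close> and a vertex that it
  does not increase there. By compactness the cells accumulate at a point \<open>t\<close>, both inequalities
  pass to the limit, and so \<open>T t i = t i\<close> for each \<open>i\<close>.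
\<close>

theorem hilbert_cube_fixed_point:
  assumes cont: "continuous_on hilbert_cube T" and maps: "T \<in> hilbert_cube \<rightarrow> hilbert_cube"
  shows "\<exists>t\<in>hilbert_cube. T t = t"
proof -
  define grid :: "nat \<Rightarrow> (nat \<Rightarrow> nat) \<Rightarrow> nat \<Rightarrow> real"
    where "grid n x = (\<lambda>i. if i < n then real (x i) / real n else 0)" for n x
  have grid_cube: "grid n x \<in> hilbert_cube" if "\<forall>i<n. x i \<le> n" for n x
    using that by (auto simp: grid_def divide_le_eq_1)
  have T_cube: "0 \<le> T t i \<and> T t i \<le> 1" if "t \<in> hilbert_cube" for t i
    using maps that by blast
  \<comment> \<open>Label 0 marks a coordinate that \<open>T\<close> does not decrease and label 1 one that it does not
    increase. The test \<open>x i \<noteq> 0\<close> is the boundary condition of Kuhn's lemma on the lower faces; on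
    the upper faces it holds because the values of \<open>T\<close> are at most 1.\<close>
  define label :: "nat \<Rightarrow> (nat \<Rightarrow> nat) \<Rightarrow> nat \<Rightarrow> nat"
    where "label n x i = (if x i \<noteq> 0 \<and> T (grid n x) i \<le> grid n x i then 1 else 0)" for n x i
  have "\<exists>q. (\<forall>i<n. q i < n) \<and> (\<forall>i<n. \<exists>r s.
      (\<forall>j<n. q j \<le> r j \<and> r j \<le> q j + 1) \<and> (\<forall>j<n. q j \<le> s j \<and> s j \<le> q j + 1) \<and>
      label n r i \<noteq> label n s i)" if "0 < n" for n
  proof (rule kuhn_lemma[OF that, where label = "label n"])
    show "\<forall>x. (\<forall>i<n. x i \<le> n) \<longrightarrow> (\<forall>i<n. label n x i = 0 \<or> label n x i = 1)"
      "\<forall>x. (\<forall>i<n. x i \<le> n) \<longrightarrow> (\<forall>i<n. x i = 0 \<longrightarrow> label n x i = 0)"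
      by (auto simp: label_def)
    show "\<forall>x. (\<forall>i<n. x i \<le> n) \<longrightarrow> (\<forall>i<n. x i = n \<longrightarrow> label n x i = 1)"
    proof (intro allI impI)
      fix x :: "nat \<Rightarrow> nat" and i assume "\<forall>i<n. x i \<le> n" "i < n" "x i = n"
      then show "label n x i = 1"
        using T_cube[OF grid_cube[of n x], of i] by (simp add: label_def grid_def)
    qed
  qed blast
  then obtain q where q: "\<And>n i. i < n \<Longrightarrow> q n i < n"
    and qlab: "\<And>n i. i < n \<Longrightarrow> \<exists>r s.
      (\<forall>j<n. q n j \<le> r j \<and> r j \<le> q n j + 1) \<and> (\<forall>j<n. q n j \<le> s j \<and> s j \<le> q n j + 1) \<and>
      label n r i \<noteq> label n s i"
    by (metis gr_zeroI less_nat_zero_code)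
  have brackets: "\<exists>u d. (\<forall>j<n. q n j \<le> u j \<and> u j \<le> q n j + 1) \<and> (\<forall>j<n. q n j \<le> d j \<and> d j \<le> q n j + 1) \<and>
      grid n u i \<le> T (grid n u) i \<and> T (grid n d) i \<le> grid n d i" if "i < n" for n i
  proof -
    have up: "grid n x i \<le> T (grid n x) i" if "label n x i = 0" "\<forall>j<n. q n j \<le> x j \<and> x j \<le> q n j + 1" for x
    proof -
      have "\<forall>j<n. x j \<le> n"
        using that(2) q by (metis Suc_eq_plus1 Suc_leI le_trans)
      from T_cube[OF grid_cube[OF this], of i] that(1) show ?thesis
        by (auto simp: label_def grid_def split: if_splits)
    qed
    have down: "T (grid n x) i \<le> grid n x i" if "label n x i \<noteq> 0" for x
      using that by (auto simp: label_def split: if_splits)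
    obtain r s where r: "\<forall>j<n. q n j \<le> r j \<and> r j \<le> q n j + 1"
      and s: "\<forall>j<n. q n j \<le> s j \<and> s j \<le> q n j + 1" and rs: "label n r i \<noteq> label n s i"
      using qlab[OF \<open>i < n\<close>] by blast
    show ?thesis
    proof (cases "label n r i = 0")
      case True
      then show ?thesis using r s rs up[OF True r] down[of s] by metis
    next
      case False
      then have "label n s i = 0"
        using rs by (auto simp: label_def split: if_splits)
      then show ?thesis using r s up[OF _ s] down[OF False] by metis
    qed
  qed
  obtain t \<phi> where t: "t \<in> hilbert_cube" and \<phi>: "strict_mono \<phi>"
    and lim: "((\<lambda>n. grid n (q n)) \<circ> \<phi>) \<longlonglongrightarrow> t"
  proof -
    have "\<forall>n. grid n (q n) \<in> hilbert_cube"
      using grid_cube q less_imp_le by blast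
    moreover have "seq_compact hilbert_cube"
      using compact_hilbert_cube by (rule compact_imp_seq_compact)
    ultimately show ?thesis
      by (metis (no_types, lifting) that seq_compactE)
  qed
  have ev: "\<forall>\<^sub>F k in sequentially. i < \<phi> k" for i
    by (rule eventually_subseq[OF \<phi> eventually_gt_at_top])
  \<comment> \<open>All vertices of the chosen cells have the same limit, since the mesh \<open>1 / n\<close> tends to zero and
    the coordinates from \<open>n\<close> on vanish.\<close>
  have near: "(\<lambda>k. grid (\<phi> k) (x k)) \<longlonglongrightarrow> t"
    if x: "\<And>k j. i < \<phi> k \<Longrightarrow> j < \<phi> k \<Longrightarrow> q (\<phi> k) j \<le> x k j \<and> x k j \<le> q (\<phi> k) j + 1" for x i
    unfolding tendsto_fun_iff
  proof
    fix j
    have "(\<lambda>k. grid (\<phi> k) (x k) j - grid (\<phi> k) (q (\<phi> k)) j) \<longlonglongrightarrow> 0"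
    proof (rule tendsto_rabs_zero_cancel, rule tendsto_sandwich[of "\<lambda>_. 0" _ _ "\<lambda>k. inverse (real (\<phi> k))"])
      show "\<forall>\<^sub>F k in sequentially. \<bar>grid (\<phi> k) (x k) j - grid (\<phi> k) (q (\<phi> k)) j\<bar> \<le> inverse (real (\<phi> k))"
        using ev[of i]
      proof eventually_elim
        case (elim k)
        show ?case
        proof (cases "j < \<phi> k")
          case True
          then have "\<bar>real (x k j) - real (q (\<phi> k) j)\<bar> \<le> 1"
            using x[OF elim True] by auto
          then show ?thesis
            using True by (simp add: grid_def flip: diff_divide_distrib) (simp add: divide_simps)
        qed (simp add: grid_def)
      qed
      show "(\<lambda>k. inverse (real (\<phi> k))) \<longlonglongrightarrow> 0"
        using LIMSEQ_subseq_LIMSEQ[OF lim_inverse_n' \<phi>] by (simp add: o_def inverse_eq_divide)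
    qed auto
    from tendsto_add[OF this lim[unfolded tendsto_fun_iff, rule_format, of j]]
    show "(\<lambda>k. grid (\<phi> k) (x k) j) \<longlonglongrightarrow> t j" by (simp add: o_def)
  qed
  have Tlim: "(\<lambda>k. T (grid (\<phi> k) (x k)) i) \<longlonglongrightarrow> T t i"
    if x: "\<And>k j. i < \<phi> k \<Longrightarrow> j < \<phi> k \<Longrightarrow> q (\<phi> k) j \<le> x k j \<and> x k j \<le> q (\<phi> k) j + 1" for x i
  proof -
    have "\<forall>\<^sub>F k in sequentially. grid (\<phi> k) (x k) \<in> hilbert_cube"
      using ev[of i]
    proof eventually_elim
      case (elim k)
      have "x k j \<le> \<phi> k" if "j < \<phi> k" for j
        using x[OF elim that] q[OF that] by linarith
      then show ?case using grid_cube by blast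
    qed
    from continuous_on_tendsto_compose[OF cont near[OF x] t this] show ?thesis
      unfolding tendsto_fun_iff by blast
  qed
  have "T t i = t i" for i
  proof -
    obtain u d where u: "\<And>n j. i < n \<Longrightarrow> j < n \<Longrightarrow> q n j \<le> u n j \<and> u n j \<le> q n j + 1"
      and d: "\<And>n j. i < n \<Longrightarrow> j < n \<Longrightarrow> q n j \<le> d n j \<and> d n j \<le> q n j + 1"
      and Tu: "\<And>n. i < n \<Longrightarrow> grid n (u n) i \<le> T (grid n (u n)) i"
      and Td: "\<And>n. i < n \<Longrightarrow> T (grid n (d n)) i \<le> grid n (d n) i"
      using brackets by metis
    have "t i \<le> T t i"
    proof (rule tendsto_le[OF sequentially_bot])
      show "(\<lambda>k. T (grid (\<phi> k) (u (\<phi> k))) i) \<longlonglongrightarrow> T t i" by (rule Tlim) (rule u)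
      show "(\<lambda>k. grid (\<phi> k) (u (\<phi> k)) i) \<longlonglongrightarrow> t i"
        using near[of i "\<lambda>k. u (\<phi> k)"] u unfolding tendsto_fun_iff by blast
      show "\<forall>\<^sub>F k in sequentially. grid (\<phi> k) (u (\<phi> k)) i \<le> T (grid (\<phi> k) (u (\<phi> k))) i"
        using ev[of i] by eventually_elim (rule Tu)
    qed
    moreover have "T t i \<le> t i"
    proof (rule tendsto_le[OF sequentially_bot])
      show "(\<lambda>k. T (grid (\<phi> k) (d (\<phi> k))) i) \<longlonglongrightarrow> T t i" by (rule Tlim) (rule d)
      show "(\<lambda>k. grid (\<phi> k) (d (\<phi> k)) i) \<longlonglongrightarrow> t i"
        using near[of i "\<lambda>k. d (\<phi> k)"] d unfolding tendsto_fun_iff by blast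
      show "\<forall>\<^sub>F k in sequentially. T (grid (\<phi> k) (d (\<phi> k))) i \<le> grid (\<phi> k) (d (\<phi> k)) i"
        using ev[of i] by eventually_elim (rule Td)
    qed
    ultimately show ?thesis by simp
  qed
  then show ?thesis using t by blast
qed

section \<open>Schauder's fixed-point theorem\<close>

text \<open>
  The tent functions of the balls are divided by the maximum of their sum and its positive minimum
  on \<open>Q\<close>. This keeps the weights continuous on the whole space, where their sum may vanish; away
  from \<open>Q\<close> they may sum to less than 1.
\<close>

lemma finite_partition_of_unity:
  fixes c :: "'i \<Rightarrow> 'a::metric_space" and r :: "'i \<Rightarrow> real"
  assumes I: "finite I" and Q: "compact Q" "Q \<subseteq> (\<Union>i\<in>I. ball (c i) (r i))"
  obtains \<theta> :: "'i \<Rightarrow> 'a \<Rightarrow> real"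
  where "\<And>i. continuous_on UNIV (\<theta> i)" "\<And>i y. 0 \<le> \<theta> i y"
    "\<And>i y. \<theta> i y \<noteq> 0 \<Longrightarrow> y \<in> ball (c i) (r i)"
    "\<And>y. (\<Sum>i\<in>I. \<theta> i y) \<le> 1" "\<And>y. y \<in> Q \<Longrightarrow> (\<Sum>i\<in>I. \<theta> i y) = 1"
proof -
  define \<mu> where "\<mu> i y = max 0 (r i - dist (c i) y)" for i y
  define s where "s y = (\<Sum>i\<in>I. \<mu> i y)" for y
  have \<mu>0: "0 \<le> \<mu> i y" for i y
    by (simp add: \<mu>_def)
  have cont_\<mu>: "continuous_on X (\<mu> i)" for i X
    unfolding \<mu>_def by (intro continuous_intros)
  have cont_s: "continuous_on X s" for X
    unfolding s_def by (intro continuous_intros cont_\<mu>)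
  have s_pos: "s y > 0" if y: "y \<in> Q" for y
  proof -
    obtain i where "i \<in> I" "y \<in> ball (c i) (r i)"
      using y Q(2) by blast
    then show ?thesis
      unfolding s_def using \<mu>0 by (intro sum_pos2[OF I, of i]) (auto simp: \<mu>_def)
  qed
  have "\<exists>\<sigma>>0. \<forall>y\<in>Q. \<sigma> \<le> s y"
  proof (cases "Q = {}")
    case False
    then show ?thesis
      using continuous_attains_inf[OF Q(1) False cont_s] s_pos by blast
  qed (auto intro: exI[of _ 1])
  then obtain \<sigma> where \<sigma>: "\<sigma> > 0" "\<And>y. y \<in> Q \<Longrightarrow> \<sigma> \<le> s y"
    by blast
  define \<theta> where "\<theta> i y = \<mu> i y / max \<sigma> (s y)" for i y
  have pos: "max \<sigma> (s y) > 0" for y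
    using \<sigma>(1) by auto
  have sum: "(\<Sum>i\<in>I. \<theta> i y) = s y / max \<sigma> (s y)" for y
    unfolding \<theta>_def s_def by (simp add: sum_divide_distrib)
  show ?thesis
  proof
    show "continuous_on UNIV (\<theta> i)" for i
      unfolding \<theta>_def using pos by (intro continuous_intros cont_\<mu> cont_s) (metis less_irrefl)
    show "0 \<le> \<theta> i y" for i y
      unfolding \<theta>_def using \<mu>0 less_imp_le[OF pos] by (rule divide_nonneg_nonneg)
    show "\<theta> i y \<noteq> 0 \<Longrightarrow> y \<in> ball (c i) (r i)" for i y
      by (auto simp: \<theta>_def \<mu>_def max_def split: if_splits)
    show "(\<Sum>i\<in>I. \<theta> i y) \<le> 1" for y
      unfolding sum using pos[of y] by (simp add: divide_le_eq_1)
    show "(\<Sum>i\<in>I. \<theta> i y) = 1" if "y \<in> Q" for y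
      unfolding sum using \<sigma>(2)[OF that] pos[of y] by (simp add: max_def)
  qed
qed

text \<open>
  A finite \<open>\<epsilon>\<close>-net and a subordinate partition of unity move \<open>F\<close> by at most \<open>\<epsilon>\<close> into the convex
  hull of the net, and the barycentric coordinates of that finite-dimensional map give a
  self-map of the Hilbert cube.
\<close>

lemma approximate_fixed_point:
  fixes F :: "'a::real_normed_vector \<Rightarrow> 'a"
  assumes S: "compact S" "convex S" "S \<noteq> {}"
    and cont: "continuous_on S F" and maps: "F \<in> S \<rightarrow> S" and \<epsilon>: "\<epsilon> > 0"
  shows "\<exists>x\<in>S. dist x (F x) \<le> \<epsilon>"
proof -
  obtain N where N: "finite N" "N \<subseteq> S" "S \<subseteq> (\<Union>x\<in>N. ball x \<epsilon>)"
    using seq_compact_imp_totally_bounded[OF compact_imp_seq_compact[OF S(1)], rule_format, OF \<epsilon>]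
    by blast
  obtain a :: "nat \<Rightarrow> 'a" and n where n: "bij_betw a {..<n} N"
    using ex_bij_betw_nat_finite[OF N(1)] by (auto simp: atLeast0LessThan)
  have a_S: "a i \<in> S" if "i < n" for i
    using n N(2) that by (auto simp: bij_betw_def)
  have cover: "S \<subseteq> (\<Union>i\<in>{..<n}. ball (a i) \<epsilon>)"
    using N(3) n by (auto simp: bij_betw_def)
  have n0: "n > 0"
    using S(3) cover by (cases n) auto
  obtain \<theta> :: "nat \<Rightarrow> 'a \<Rightarrow> real" where \<theta>: "\<And>i. continuous_on UNIV (\<theta> i)" "\<And>i y. 0 \<le> \<theta> i y"
    "\<And>i y. \<theta> i y \<noteq> 0 \<Longrightarrow> y \<in> ball (a i) \<epsilon>"
    "\<And>y. y \<in> S \<Longrightarrow> (\<Sum>i<n. \<theta> i y) = 1"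
    using finite_partition_of_unity[OF finite_lessThan S(1) cover] by metis
  \<comment> \<open>A retraction of the cube onto the simplex of barycentric weights: a deficit of the coordinate
    sum is shared out equally and an excess is scaled away.\<close>
  define w :: "(nat \<Rightarrow> real) \<Rightarrow> nat \<Rightarrow> real" where
    "w t i = (t i + max 0 (1 - (\<Sum>i<n. t i)) / real n) / max 1 (\<Sum>i<n. t i)" for t i
  define x where "x t = (\<Sum>i<n. w t i *\<^sub>R a i)" for t
  have w0: "0 \<le> w t i" if "t \<in> hilbert_cube" for t i
    using that unfolding w_def by (intro divide_nonneg_nonneg add_nonneg_nonneg) auto
  have w1: "(\<Sum>i<n. w t i) = 1" for t
  proof -
    have "(\<Sum>i<n. w t i) = ((\<Sum>i<n. t i) + max 0 (1 - (\<Sum>i<n. t i))) / max 1 (\<Sum>i<n. t i)"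
      unfolding w_def using n0 by (simp add: sum.distrib flip: sum_divide_distrib)
    also have "\<dots> = 1" by (auto simp: max_def)
    finally show ?thesis .
  qed
  have x_S: "x t \<in> S" if "t \<in> hilbert_cube" for t
    unfolding x_def using w0[OF that] w1 a_S by (intro convex_sum S(2)) auto
  have cont_coord: "continuous_on X (\<lambda>t::nat \<Rightarrow> real. t i)" for X i
    by (rule continuous_on_subset[OF continuous_on_product_coordinates subset_UNIV])
  have cont_x: "continuous_on hilbert_cube x"
    unfolding x_def w_def
    by (intro continuous_intros cont_coord) (use n0 in \<open>auto simp: max_def\<close>)
  define T where "T t i = (if i < n then \<theta> i (F (x t)) else 0)" for t i
  have Fx: "F (x t) \<in> S" if "t \<in> hilbert_cube" for t
    using maps x_S[OF that] by blast
  have "continuous_on hilbert_cube T"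
  proof (rule continuous_on_coordinatewise_then_product)
    fix i
    have "continuous_on hilbert_cube (\<lambda>t. \<theta> i (F (x t)))"
      by (rule continuous_on_compose2[OF \<theta>(1)], rule continuous_on_compose2[OF cont cont_x])
        (use x_S in auto)
    then show "continuous_on hilbert_cube (\<lambda>t. T t i)"
      by (cases "i < n") (auto simp: T_def)
  qed
  moreover have "T \<in> hilbert_cube \<rightarrow> hilbert_cube"
  proof (intro funcsetI CollectI allI)
    fix t i assume t: "t \<in> hilbert_cube"
    show "0 \<le> T t i \<and> T t i \<le> 1"
    proof (cases "i < n")
      case True
      then have "\<theta> i (F (x t)) \<le> (\<Sum>i<n. \<theta> i (F (x t)))"
        using \<theta>(2) by (intro member_le_sum) auto
      then show ?thesis
        using True \<theta>(2) \<theta>(4)[OF Fx[OF t]] by (simp add: T_def)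
    qed (simp add: T_def)
  qed
  ultimately obtain t where t: "t \<in> hilbert_cube" "T t = t"
    using hilbert_cube_fixed_point by blast
  have ti: "t i = \<theta> i (F (x t))" if "i < n" for i
    using fun_cong[OF t(2), of i] that by (simp add: T_def)
  \<comment> \<open>At a fixed point the coordinates are already barycentric, so that the retraction drops out.\<close>
  then have sum_t: "(\<Sum>i<n. t i) = 1"
    using \<theta>(4)[OF Fx[OF t(1)]] by simp
  have xt: "x t = (\<Sum>i<n. t i *\<^sub>R a i)"
    unfolding x_def w_def sum_t by simp
  have "x t - F (x t) = (\<Sum>i<n. t i *\<^sub>R (a i - F (x t)))"
    by (simp add: xt scaleR_diff_right sum_subtractf sum_t flip: scaleR_sum_left)
  then have "norm (x t - F (x t)) \<le> (\<Sum>i<n. norm (t i *\<^sub>R (a i - F (x t))))"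
    by (metis norm_sum)
  also have "\<dots> \<le> (\<Sum>i<n. t i * \<epsilon>)"
  proof (rule sum_mono)
    fix i assume i: "i \<in> {..<n}"
    show "norm (t i *\<^sub>R (a i - F (x t))) \<le> t i * \<epsilon>"
    proof (cases "t i = 0")
      case False
      then have "F (x t) \<in> ball (a i) \<epsilon>"
        using ti i \<theta>(3) by auto
      then show ?thesis
        using t(1) by (auto simp: dist_norm intro!: mult_left_mono)
    qed simp
  qed
  also have "\<dots> = \<epsilon>"
    by (simp add: sum_t flip: sum_distrib_right)
  finally show ?thesis
    using x_S[OF t(1)] by (auto simp: dist_norm)
qed

text \<open>
  The displacement attains its infimum on the compact set, and approximate fixed points show that
  the infimum is zero.
\<close>

theorem schauder_fixed_point:
  fixes F :: "'a::real_normed_vector \<Rightarrow> 'a"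
  assumes S: "compact S" "convex S" "S \<noteq> {}"
    and cont: "continuous_on S F" and maps: "F \<in> S \<rightarrow> S"
  shows "\<exists>x\<in>S. F x = x"
proof -
  have "continuous_on S (\<lambda>x. dist x (F x))"
    by (intro continuous_intros cont)
  then obtain x where x: "x \<in> S" "\<And>y. y \<in> S \<Longrightarrow> dist x (F x) \<le> dist y (F y)"
    using continuous_attains_inf[OF S(1,3)] by blast
  have "dist x (F x) \<le> \<epsilon>" if "\<epsilon> > 0" for \<epsilon>
    using approximate_fixed_point[OF assms that] x(2) by (meson order_trans)
  then have "dist x (F x) \<le> 0"
    by (rule field_le_epsilon[of _ 0, simplified])
  then have "F x = x" by simp
  then show ?thesis using x(1) by blast
qed

section \<open>Separation of points by bounded functionals\<close>

text \<open>
  Homogeneity is required as an inequality only, because that is all that has to be checked for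
  infima; applying it to \<open>1 / c\<close> gives equality.
\<close>

definition sublinear :: "('a::real_vector \<Rightarrow> real) \<Rightarrow> bool" where
  "sublinear p \<longleftrightarrow> (\<forall>x y. p (x + y) \<le> p x + p y) \<and> (\<forall>c>0. \<forall>x. p (c *\<^sub>R x) \<le> c * p x)"

lemma sublinear_scaleR:
  assumes "sublinear p" "c > 0"
  shows "p (c *\<^sub>R x) = c * p x"
proof (rule antisym)
  show "p (c *\<^sub>R x) \<le> c * p x"
    using assms by (auto simp: sublinear_def)
  have "p ((1 / c) *\<^sub>R (c *\<^sub>R x)) \<le> (1 / c) * p (c *\<^sub>R x)"
    using assms unfolding sublinear_def by (metis zero_less_divide_1_iff)
  then show "c * p x \<le> p (c *\<^sub>R x)"
    using assms(2) by (simp add: field_simps)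
qed

lemma sublinear_0: "sublinear p \<Longrightarrow> p 0 = 0"
  using sublinear_scaleR[of p 2 0] by simp

lemma sublinear_lower_bound: "sublinear p \<Longrightarrow> - p (- x) \<le> p x"
  unfolding sublinear_def using sublinear_0[of p, unfolded sublinear_def]
  by (smt (verit) add.right_inverse)

text \<open>
  This is the largest sublinear functional \<open>q \<le> p\<close> with \<open>q (- a) \<le> - p a\<close>, that is, \<open>p\<close> lowered until
  it is linear on the line through \<open>a\<close>. The construction serves twice: it shows that minimal sublinear
  functionals are linear, and it makes the functional that is found nonzero at a given point.
\<close>

definition flatten :: "('a::real_vector \<Rightarrow> real) \<Rightarrow> 'a \<Rightarrow> 'a \<Rightarrow> real" where
  "flatten p a x = (INF t\<in>{0..}. p (x + t *\<^sub>R a) - t * p a)"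

lemma flatten_le:
  assumes p: "sublinear p" and "t \<ge> 0"
  shows "flatten p a x \<le> p (x + t *\<^sub>R a) - t * p a"
  unfolding flatten_def
proof (rule cINF_lower)
  have "- p (- x) \<le> p (x + t *\<^sub>R a) - t * p a" if "t \<ge> 0" for t
  proof -
    have "p (t *\<^sub>R a) = t * p a"
      using sublinear_scaleR[OF p, of t a] sublinear_0[OF p] that by (cases "t = 0") auto
    moreover have "p ((x + t *\<^sub>R a) + - x) \<le> p (x + t *\<^sub>R a) + p (- x)"
      using p unfolding sublinear_def by blast
    ultimately show ?thesis by simp
  qed
  then show "bdd_below ((\<lambda>t. p (x + t *\<^sub>R a) - t * p a) ` {0..})"
    by (auto intro!: bdd_belowI)
qed (use assms in auto)

lemma sublinear_flatten:
  assumes p: "sublinear p"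
  shows "sublinear (flatten p a)"
  unfolding sublinear_def
proof (intro conjI allI impI)
  fix x y
  have *: "flatten p a (x + y) \<le> (p (x + s *\<^sub>R a) - s * p a) + (p (y + t *\<^sub>R a) - t * p a)"
    if "s \<ge> 0" "t \<ge> 0" for s t
  proof -
    have "flatten p a (x + y) \<le> p ((x + y) + (s + t) *\<^sub>R a) - (s + t) * p a"
      using that by (intro flatten_le[OF p]) auto
    also have "(x + y) + (s + t) *\<^sub>R a = (x + s *\<^sub>R a) + (y + t *\<^sub>R a)"
      by (simp add: algebra_simps)
    also have "p \<dots> \<le> p (x + s *\<^sub>R a) + p (y + t *\<^sub>R a)"
      using p unfolding sublinear_def by blast
    finally show ?thesis by (simp add: algebra_simps)
  qed
  have "flatten p a (x + y) - (p (x + s *\<^sub>R a) - s * p a) \<le> flatten p a y" if "s \<ge> 0" for s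
    unfolding flatten_def[of p a y] using *[OF that] by (intro cINF_greatest) (auto simp: algebra_simps)
  then have "flatten p a (x + y) - flatten p a y \<le> flatten p a x"
    unfolding flatten_def[of p a x] by (intro cINF_greatest) (auto simp: algebra_simps)
  then show "flatten p a (x + y) \<le> flatten p a x + flatten p a y" by simp
next
  fix c :: real and x assume c: "c > 0"
  have "flatten p a (c *\<^sub>R x) / c \<le> p (x + t *\<^sub>R a) - t * p a" if "t \<ge> 0" for t
  proof -
    have "flatten p a (c *\<^sub>R x) \<le> p (c *\<^sub>R x + (c * t) *\<^sub>R a) - (c * t) * p a"
      using that c by (intro flatten_le[OF p]) auto
    also have "c *\<^sub>R x + (c * t) *\<^sub>R a = c *\<^sub>R (x + t *\<^sub>R a)"
      by (simp add: algebra_simps)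
    finally have "flatten p a (c *\<^sub>R x) \<le> (p (x + t *\<^sub>R a) - t * p a) * c"
      unfolding sublinear_scaleR[OF p c] by (simp add: algebra_simps)
    then show ?thesis
      using c by (simp add: pos_divide_le_eq)
  qed
  then have "flatten p a (c *\<^sub>R x) / c \<le> flatten p a x"
    unfolding flatten_def[of p a x] by (intro cINF_greatest) auto
  then show "flatten p a (c *\<^sub>R x) \<le> c * flatten p a x"
    using c by (simp add: field_simps)
qed

text \<open>
  Zorn's lemma applies because the pointwise infimum of a chain is sublinear: any two members of the
  chain can be compared, and so subadditivity of the smaller one bounds the sum. The values
  cannot drop to minus infinity, since \<open>q x \<ge> - q (- x) \<ge> - p (- x)\<close>.
\<close>

lemma minimal_sublinear_exists:
  assumes p: "sublinear p"
  obtains m where "sublinear m" "m \<le> p" "\<And>q. sublinear q \<Longrightarrow> q \<le> m \<Longrightarrow> q = m"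
proof -
  let ?A = "{q. sublinear q \<and> q \<le> p}"
  have "\<exists>m\<in>?A. \<forall>q\<in>?A. m \<ge> q \<longrightarrow> q = m"
  proof (rule predicate_Zorn)
    show "partial_order_on ?A (relation_of (\<ge>) ?A)"
      by (intro partial_order_on_relation_ofI) auto
    fix C assume C: "C \<in> Chains (relation_of (\<ge>) ?A)"
    then have CA: "sublinear q" "q \<le> p" if "q \<in> C" for q
      using Chains_relation_of that by blast+
    have total: "q \<le> r \<or> r \<le> q" if "q \<in> C" "r \<in> C" for q r
      using C that by (auto simp: Chains_def relation_of_def)
    show "\<exists>u\<in>?A. \<forall>q\<in>C. q \<ge> u"
    proof (cases "C = {}")
      case False
      define u where "u x = (INF q\<in>C. q x)" for x
      have "- p (- x) \<le> q x" if "q \<in> C" for q x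
        using sublinear_lower_bound[OF CA(1)[OF that], of x] CA(2)[OF that] le_funD[of q p "- x"] by linarith
      then have bdd: "bdd_below ((\<lambda>q. q x) ` C)" for x
        by (auto intro!: bdd_belowI)
      have u_le: "u x \<le> q x" if "q \<in> C" for q x
        unfolding u_def using that by (intro cINF_lower bdd)
      have "sublinear u"
        unfolding sublinear_def
      proof (intro conjI allI impI)
        fix x y
        have *: "u (x + y) \<le> q x + r y" if qr: "q \<in> C" "r \<in> C" for q r
        proof -
          obtain s where s: "s \<in> C" "s \<le> q" "s \<le> r"
            using total[OF qr] qr by auto
          have "u (x + y) \<le> s (x + y)" using u_le[OF s(1)] .
          also have "\<dots> \<le> s x + s y" using CA(1)[OF s(1)] by (auto simp: sublinear_def)
          also have "\<dots> \<le> q x + r y" using s by (intro add_mono) (auto dest: le_funD)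
          finally show ?thesis .
        qed
        have "u (x + y) - q x \<le> u y" if "q \<in> C" for q
          unfolding u_def[of y] using *[OF that] False by (intro cINF_greatest) (auto simp: algebra_simps)
        then have "u (x + y) - u y \<le> u x"
          unfolding u_def[of x] using False by (intro cINF_greatest) (auto simp: algebra_simps)
        then show "u (x + y) \<le> u x + u y" by simp
      next
        fix c :: real and x assume c: "c > 0"
        have "u (c *\<^sub>R x) / c \<le> u x"
          unfolding u_def[of x]
        proof (rule cINF_greatest[OF False])
          fix q assume "q \<in> C"
          then show "u (c *\<^sub>R x) / c \<le> q x"
            using u_le[of q "c *\<^sub>R x"] sublinear_scaleR[OF CA(1) c, of q x] c by (simp add: field_simps)
        qed
        then show "u (c *\<^sub>R x) \<le> c * u x"
          using c by (simp add: field_simps)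
      qed
      moreover have "u \<le> p"
        using False u_le CA(2) by (meson ex_in_conv le_funD le_funI order_trans)
      ultimately show ?thesis
        using u_le by (auto simp: le_fun_def)
    qed (use p in auto)
  qed
  then show ?thesis
    using that by (auto intro: order_trans)
qed

text \<open>
  By minimality \<open>flatten m a = m\<close> for every direction \<open>a\<close>, which turns subadditivity into additivity.
\<close>

lemma minimal_sublinear_linear:
  assumes m: "sublinear m" and min: "\<And>q. sublinear q \<Longrightarrow> q \<le> m \<Longrightarrow> q = m"
  shows "linear m"
proof -
  have flat: "flatten m a = m" for a
  proof (rule min[OF sublinear_flatten[OF m]])
    show "flatten m a \<le> m"
      using flatten_le[OF m, of 0 a] by (auto simp: le_fun_def)
  qed
  have add: "m (x + a) = m x + m a" for x a
  proof (rule antisym)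
    show "m (x + a) \<le> m x + m a"
      using m by (auto simp: sublinear_def)
    show "m x + m a \<le> m (x + a)"
      using flatten_le[OF m, of 1 a x] by (simp add: flat)
  qed
  have neg: "m (- x) = - m x" for x
    using add[of x "- x"] sublinear_0[OF m] by simp
  have "m (c *\<^sub>R x) = c * m x" for c x
  proof -
    consider "c > 0" | "c = 0" | "- c > 0" by linarith
    then show ?thesis
    proof cases
      case 3
      then show ?thesis
        using sublinear_scaleR[OF m 3, of x] neg[of "c *\<^sub>R x"] by simp
    qed (auto simp: sublinear_scaleR[OF m] sublinear_0[OF m])
  qed
  then show ?thesis
    using add by (intro linearI) auto
qed

text \<open>
  This is the part of the Hahn--Banach theorem that makes the weak topology Hausdorff. A minimal
  functional below the norm flattened along \<open>y\<close> is linear, has norm at most 1 and takes a value of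
  at most \<open>- \<parallel>y\<parallel>\<close> at \<open>- y\<close>.
\<close>

theorem bounded_functional_separates:
  fixes y :: "'a::real_normed_vector"
  assumes "y \<noteq> 0"
  shows "\<exists>f :: 'a \<Rightarrow>\<^sub>L real. blinfun_apply f y \<noteq> 0"
proof -
  have nrm: "sublinear (norm :: 'a \<Rightarrow> real)"
    by (auto simp: sublinear_def norm_triangle_ineq)
  obtain m where m: "sublinear m" "m \<le> flatten norm y" "\<And>q. sublinear q \<Longrightarrow> q \<le> m \<Longrightarrow> q = m"
    using minimal_sublinear_exists[OF sublinear_flatten[OF nrm]] by blast
  have lin: "linear m"
    using minimal_sublinear_linear m by blast
  have le: "m x \<le> norm (x + t *\<^sub>R y) - t * norm y" if "t \<ge> 0" for x t
    using m(2) flatten_le[OF nrm that] by (meson le_funD order_trans)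
  have "norm (m x) \<le> norm x * 1" for x
    using le[of 0 x] le[of 0 "- x"] linear_neg[OF lin, of x] by auto
  then have bl: "bounded_linear m"
    using linear_add[OF lin] linear_cmul[OF lin] by (intro bounded_linear_intro)
  have "m (- y) \<le> - norm y"
    using le[of 1 "- y"] by simp
  then have "m y \<noteq> 0"
    using assms linear_neg[OF lin, of y] by auto
  then show ?thesis
    using bounded_linear_Blinfun_apply[OF bl] by metis
qed

section \<open>Images of weakly compact sets\<close>

text \<open>
  If \<open>p\<close> is not in the image, then each \<open>z \<in> S\<close> has a functional that keeps a weak neighbourhood of
  \<open>z\<close> away from \<open>p\<close> after \<open>J\<close>. Finitely many of these neighbourhoods cover \<open>S\<close>, and their finitely
  many functionals define a norm neighbourhood of \<open>p\<close> that the image misses.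
\<close>

lemma closed_image_weakly_compact:
  fixes J :: "'a::real_normed_vector \<Rightarrow> 'b::real_normed_vector"
  assumes J: "bounded_linear J" and S: "compactin weak_topology S"
  shows "closed (J ` S)"
proof (rule ccontr)
  assume "\<not> closed (J ` S)"
  then obtain p where p: "p \<in> closure (J ` S)" "p \<notin> J ` S"
    by (metis closure_subset_eq subsetI)
  have "\<exists>f :: 'b \<Rightarrow>\<^sub>L real. blinfun_apply f (J z - p) \<noteq> 0" if "z \<in> S" for z
    using that p(2) by (intro bounded_functional_separates) auto
  then obtain f :: "'a \<Rightarrow> 'b \<Rightarrow>\<^sub>L real" where f: "\<And>z. z \<in> S \<Longrightarrow> blinfun_apply (f z) (J z - p) \<noteq> 0"
    by metis
  define U where "U z = {x. \<bar>blinfun_apply (f z) (J x - p)\<bar> > \<bar>blinfun_apply (f z) (J z - p)\<bar> / 2}" for z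
  have openU: "openin weak_topology (U z)" for z
  proof -
    define g :: "'a \<Rightarrow>\<^sub>L real" where "g = Blinfun (\<lambda>x. blinfun_apply (f z) (J x))"
    have g: "blinfun_apply g x = blinfun_apply (f z) (J x)" for x
      unfolding g_def
      by (subst bounded_linear_Blinfun_apply)
        (auto intro: bounded_linear_compose[OF blinfun.bounded_linear_right J])
    let ?V = "{\<phi> :: ('a \<Rightarrow>\<^sub>L real) \<Rightarrow> real. \<bar>\<phi> g - blinfun_apply (f z) p\<bar> > \<bar>blinfun_apply (f z) (J z - p)\<bar> / 2}"
    have "open ?V"
      by (intro open_Collect_less continuous_intros continuous_on_product_coordinates)
    moreover have "U z = (\<lambda>x f. blinfun_apply f x) -` ?V \<inter> UNIV"
      by (auto simp: U_def g blinfun.diff_right)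
    ultimately show ?thesis
      unfolding weak_topology_def openin_pullback_topology by auto
  qed
  have "S \<subseteq> \<Union> (U ` S)"
    using f by (auto simp: U_def)
  then obtain F where F: "finite F" "F \<subseteq> S" "S \<subseteq> \<Union> (U ` F)"
    using S openU unfolding compactin_def
    by (metis (no_types, lifting) finite_subset_image imageE)
  let ?W = "\<Inter>z\<in>F. {x. \<bar>blinfun_apply (f z) (x - p)\<bar> < \<bar>blinfun_apply (f z) (J z - p)\<bar> / 2}"
  have "open ?W"
    using F(1) by (intro open_INT ballI open_Collect_less continuous_intros) auto
  moreover have "p \<in> ?W"
    using F(2) f by auto
  ultimately obtain z where "z \<in> S" "J z \<in> ?W"
    using p(1) open_Int_closure_eq_empty[of ?W "J ` S"] by blast
  then show False
    using F(3) by (fastforce simp: U_def)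
qed

section \<open>Tangent approximations of set-valued maps\<close>

text \<open>
  A contingent direction is a limit of directions that point at elements of \<open>K\<close>. The latter have the
  advantage that, with \<open>h\<close> and \<open>k\<close> kept fixed, they vary continuously with the base point and remain
  tangent to a convex set.
\<close>

lemma contingent_cone_approx:
  assumes v: "v \<in> contingent_cone K x" and K: "K \<noteq> {}" and \<epsilon>: "\<epsilon> > 0"
  shows "\<exists>h>0. \<exists>k\<in>K. dist v ((1 / h) *\<^sub>R (k - x)) < \<epsilon>"
proof (rule ccontr)
  assume neg: "\<not> ?thesis"
  have far: "\<epsilon> \<le> infdist (x + h *\<^sub>R v) K / h" if h: "h > 0" for h
  proof -
    have "h * \<epsilon> \<le> dist (x + h *\<^sub>R v) k" if "k \<in> K" for k
    proof -
      have "x + h *\<^sub>R v - k = h *\<^sub>R (v - (1 / h) *\<^sub>R (k - x))"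
        using h by (simp add: algebra_simps)
      then have "dist (x + h *\<^sub>R v) k = h * dist v ((1 / h) *\<^sub>R (k - x))"
        using h by (simp add: dist_norm)
      then show ?thesis
        using neg that h by (simp add: not_less) (metis not_le)
    qed
    then have "h * \<epsilon> \<le> infdist (x + h *\<^sub>R v) K"
      unfolding infdist_notempty[OF K] by (intro cINF_greatest K)
    then show ?thesis
      using h by (simp add: pos_le_divide_eq mult.commute)
  qed
  have "ereal \<epsilon> \<le> Liminf (at_right 0) (\<lambda>h::real. ereal (infdist (x + h *\<^sub>R v) K / h))"
    by (intro Liminf_bounded eventually_at_right_less[THEN eventually_mono]) (use far in auto)
  then show False
    using v \<epsilon> by (simp add: contingent_cone_def)
qed

lemma infdist_lessE:
  assumes "infdist x S < e" "S \<noteq> {}"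
  obtains s where "s \<in> S" "dist x s < e"
proof -
  have "bdd_below (dist x ` S)"
    by (auto intro: bdd_belowI[of _ 0])
  then show ?thesis
    using assms that unfolding infdist_notempty[OF assms(2)] by (auto simp: cINF_less_iff)
qed

text \<open>
  The missing weight is put on \<open>a\<close>. Points of weight zero need not lie in \<open>C\<close>, which suits weights from
  a partition of unity, where the points are controlled on the supports only.
\<close>

lemma convex_sum_le_1:
  assumes C: "convex C" "a \<in> C" and I: "finite I"
    and \<theta>: "\<And>i. i \<in> I \<Longrightarrow> 0 \<le> \<theta> i" "(\<Sum>i\<in>I. \<theta> i) \<le> 1"
    and y: "\<And>i. i \<in> I \<Longrightarrow> \<theta> i \<noteq> 0 \<Longrightarrow> y i \<in> C"
  shows "a + (\<Sum>i\<in>I. \<theta> i *\<^sub>R (y i - a)) \<in> C"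
proof -
  define s where "s = (\<Sum>i\<in>I. \<theta> i)"
  have s0: "0 \<le> s" unfolding s_def by (intro sum_nonneg \<theta>)
  show ?thesis
  proof (cases "s = 0")
    case True
    then have "\<theta> i = 0" if "i \<in> I" for i
      using \<theta>(1) I that unfolding s_def by (simp add: sum_nonneg_eq_0_iff)
    then show ?thesis using C(2) by simp
  next
    case False
    define z where "z i = (if \<theta> i = 0 then a else y i)" for i
    have "(\<Sum>i\<in>I. (\<theta> i / s) *\<^sub>R z i) \<in> C"
    proof (rule convex_sum[OF I C(1)])
      show "(\<Sum>i\<in>I. \<theta> i / s) = 1"
        using False unfolding s_def by (simp flip: sum_divide_distrib)
    qed (use \<theta>(1) s0 y C(2) in \<open>auto simp: z_def\<close>)
    then have "(1 - s) *\<^sub>R a + s *\<^sub>R (\<Sum>i\<in>I. (\<theta> i / s) *\<^sub>R z i) \<in> C"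
      using s0 \<theta>(2) C by (intro convexD) (auto simp: s_def)
    moreover have "s *\<^sub>R (\<Sum>i\<in>I. (\<theta> i / s) *\<^sub>R z i) = (\<Sum>i\<in>I. \<theta> i *\<^sub>R y i)"
      using False unfolding scaleR_sum_right by (intro sum.cong) (auto simp: z_def)
    moreover have "(\<Sum>i\<in>I. \<theta> i *\<^sub>R (y i - a)) = (\<Sum>i\<in>I. \<theta> i *\<^sub>R y i) - s *\<^sub>R a"
      by (simp add: s_def scaleR_diff_right sum_subtractf scaleR_sum_left)
    ultimately have "(1 - s) *\<^sub>R a + ((\<Sum>i\<in>I. \<theta> i *\<^sub>R (y i - a)) + s *\<^sub>R a) \<in> C"
      by simp
    moreover have "(1 - s) *\<^sub>R a + (b + s *\<^sub>R a) = a + b" for b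
      by (simp add: algebra_simps)
    ultimately show ?thesis by simp
  qed
qed

text \<open>
  The continuous substitute for \<open>\<Phi>\<close>. Near \<open>x\<close> it is taken to be \<open>y \<mapsto> (k - j y) / h\<close>, a direction that points
  from \<open>j y\<close> at a fixed point \<open>k \<in> K\<close> and that is close to a tangent value in \<open>\<Phi> x\<close>; finitely many such fields,
  enough for the compact set \<open>Q\<close>, are glued by a partition of unity. Steps no longer than the smallest
  of the finitely many \<open>h\<close> cannot leave \<open>K\<close>, by convexity, and this holds on the whole of \<open>K\<^sub>0\<close> although
  \<open>f\<close> resembles \<open>\<Phi>\<close> only on \<open>Q\<close>, where the weights sum to 1. The tangency is therefore exact and
  uniform, which a pointwise use of the contingent cone would not give.
\<close>

theorem tangent_graph_approximation:
  fixes K :: "'a::real_normed_vector set" and j :: "'b::real_normed_vector \<Rightarrow> 'a"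
  assumes K: "convex K" and j: "continuous_on K\<^sub>0 j" "j ` K\<^sub>0 \<subseteq> K"
    and usc: "H_usc_on K\<^sub>0 \<Phi>"
    and convex_values: "\<And>u. u \<in> K\<^sub>0 \<Longrightarrow> convex (\<Phi> u)"
    and tangency: "\<And>u. u \<in> K\<^sub>0 \<Longrightarrow> \<Phi> u \<inter> contingent_cone K (j u) \<noteq> {}"
    and M: "\<And>u w. u \<in> K\<^sub>0 \<Longrightarrow> w \<in> \<Phi> u \<Longrightarrow> norm w \<le> M"
    and Q: "compact Q" "Q \<subseteq> K\<^sub>0" and \<epsilon>: "\<epsilon> > 0"
  shows "\<exists>f \<eta>. continuous_on K\<^sub>0 f \<and> \<eta> > 0 \<and>
    (\<forall>u\<in>K\<^sub>0. \<forall>h\<in>{0<..\<eta>}. j u + h *\<^sub>R f u \<in> K) \<and>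
    (\<forall>u\<in>K\<^sub>0. norm (f u) \<le> M + \<epsilon>) \<and>
    (\<forall>u\<in>Q. \<exists>x\<in>K\<^sub>0. dist x u < \<epsilon> \<and> (\<exists>z\<in>\<Phi> x. dist z (f u) \<le> \<epsilon>))"
proof -
  define good_at where "good_at x w h k d \<longleftrightarrow> w \<in> \<Phi> x \<and> h > 0 \<and> k \<in> K \<and> 0 < d \<and> d \<le> \<epsilon> \<and>
      (\<forall>y\<in>K\<^sub>0. dist x y < d \<longrightarrow> dist w ((1 / h) *\<^sub>R (k - j y)) < \<epsilon> / 2) \<and>
      (\<forall>y\<in>K\<^sub>0. dist x y < 2 * d \<longrightarrow> \<Phi> y \<subseteq> {z. infdist z (\<Phi> x) < \<epsilon> / 2})" for x w h k d
  have "\<exists>w h k d. good_at x w h k d"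
    if x: "x \<in> K\<^sub>0" for x
  proof -
    obtain w where w: "w \<in> \<Phi> x" "w \<in> contingent_cone K (j x)"
      using tangency[OF x] by blast
    have "K \<noteq> {}" using x j(2) by blast
    then obtain h k where h: "h > 0" and k: "k \<in> K" and near: "dist w ((1 / h) *\<^sub>R (k - j x)) < \<epsilon> / 2"
      using contingent_cone_approx[OF w(2), of "\<epsilon> / 2"] \<epsilon> by auto
    have "continuous_on K\<^sub>0 (\<lambda>y. dist w ((1 / h) *\<^sub>R (k - j y)))"
      by (intro continuous_intros j(1))
    then have "\<exists>d>0. \<forall>y\<in>K\<^sub>0. dist y x < d \<longrightarrow>
        dist (dist w ((1 / h) *\<^sub>R (k - j y))) (dist w ((1 / h) *\<^sub>R (k - j x))) < \<epsilon> / 2 - dist w ((1 / h) *\<^sub>R (k - j x))"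
      using x near unfolding continuous_on_iff by (metis diff_gt_0_iff_gt)
    then obtain d1 where d1: "d1 > 0"
      "\<And>y. y \<in> K\<^sub>0 \<Longrightarrow> dist y x < d1 \<Longrightarrow>
        dist (dist w ((1 / h) *\<^sub>R (k - j y))) (dist w ((1 / h) *\<^sub>R (k - j x))) < \<epsilon> / 2 - dist w ((1 / h) *\<^sub>R (k - j x))"
      by blast
    obtain d2 where d2: "d2 > 0"
      "\<And>y. y \<in> K\<^sub>0 \<Longrightarrow> norm (y - x) < d2 \<Longrightarrow> \<Phi> y \<subseteq> {z. infdist z (\<Phi> x) < \<epsilon> / 2}"
      using usc x half_gt_zero[OF \<epsilon>] unfolding H_usc_on_def by meson
    define d where "d = min \<epsilon> (min d1 (d2 / 2))"
    have "d > 0" "d \<le> \<epsilon>" "d \<le> d1" "2 * d \<le> d2"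
      using \<epsilon> d1(1) d2(1) by (auto simp: d_def)
    moreover have "dist w ((1 / h) *\<^sub>R (k - j y)) < \<epsilon> / 2" if "y \<in> K\<^sub>0" "dist x y < d" for y
      using d1(2)[of y] that \<open>d \<le> d1\<close> by (simp add: dist_commute dist_real_def)
    moreover have "\<Phi> y \<subseteq> {z. infdist z (\<Phi> x) < \<epsilon> / 2}" if "y \<in> K\<^sub>0" "dist x y < 2 * d" for y
      using d2(2)[of y] that \<open>2 * d \<le> d2\<close> by (simp add: dist_norm norm_minus_commute)
    ultimately show ?thesis
      unfolding good_at_def using w(1) h k by blast
  qed
  then obtain w h k d where good: "\<And>x. x \<in> K\<^sub>0 \<Longrightarrow> good_at x (w x) (h x) (k x) (d x)"
    by metis
  then have w: "\<And>x. x \<in> K\<^sub>0 \<Longrightarrow> w x \<in> \<Phi> x" and h: "\<And>x. x \<in> K\<^sub>0 \<Longrightarrow> h x > (0::real)"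
    and k: "\<And>x. x \<in> K\<^sub>0 \<Longrightarrow> k x \<in> K" and d: "\<And>x. x \<in> K\<^sub>0 \<Longrightarrow> d x > 0" "\<And>x. x \<in> K\<^sub>0 \<Longrightarrow> d x \<le> \<epsilon>"
    and near: "\<And>x y. x \<in> K\<^sub>0 \<Longrightarrow> y \<in> K\<^sub>0 \<Longrightarrow> dist x y < d x \<Longrightarrow> dist (w x) ((1 / h x) *\<^sub>R (k x - j y)) < \<epsilon> / 2"
    and values_near: "\<And>x y. x \<in> K\<^sub>0 \<Longrightarrow> y \<in> K\<^sub>0 \<Longrightarrow> dist x y < 2 * d x \<Longrightarrow> \<Phi> y \<subseteq> {z. infdist z (\<Phi> x) < \<epsilon> / 2}"
    unfolding good_at_def by blast+
  have "Q \<subseteq> (\<Union>x\<in>Q. ball x (d x))"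
  proof
    fix x assume "x \<in> Q"
    then have "x \<in> ball x (d x)" using d(1) Q(2) by auto
    then show "x \<in> (\<Union>x\<in>Q. ball x (d x))" using \<open>x \<in> Q\<close> by blast
  qed
  then obtain I where I: "I \<subseteq> Q" "finite I" "Q \<subseteq> (\<Union>x\<in>I. ball x (d x))"
    using compactE_image[OF Q(1), of Q "\<lambda>x. ball x (d x)"] by auto
  have IK: "i \<in> K\<^sub>0" if "i \<in> I" for i
    using that I(1) Q(2) by blast
  obtain \<theta> :: "'b \<Rightarrow> 'b \<Rightarrow> real" where \<theta>: "\<And>i. continuous_on UNIV (\<theta> i)" "\<And>i y. 0 \<le> \<theta> i y"
    "\<And>i y. \<theta> i y \<noteq> 0 \<Longrightarrow> dist i y < d i"
    "\<And>y. (\<Sum>i\<in>I. \<theta> i y) \<le> 1" "\<And>y. y \<in> Q \<Longrightarrow> (\<Sum>i\<in>I. \<theta> i y) = 1"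
    using finite_partition_of_unity[OF I(2) Q(1) I(3)] by (metis mem_ball)
  define v where "v i u = (1 / h i) *\<^sub>R (k i - j u)" for i u
  define f where "f u = (\<Sum>i\<in>I. \<theta> i u *\<^sub>R v i u)" for u
  \<comment> \<open>The 1 covers the case \<open>I = {}\<close>.\<close>
  define \<eta> where "\<eta> = Min (insert 1 (h ` I))"
  have \<eta>: "\<eta> > 0" "\<And>i. i \<in> I \<Longrightarrow> \<eta> \<le> h i"
    using I(2) h IK by (auto simp: \<eta>_def)
  have v_near: "dist (w i) (v i u) < \<epsilon> / 2" if "i \<in> I" "u \<in> K\<^sub>0" "\<theta> i u \<noteq> 0" for i u
    unfolding v_def using near[OF IK] that \<theta>(3) by blast
  show ?thesis
  proof (intro exI[of _ f] exI[of _ \<eta>] conjI ballI)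
    show "continuous_on K\<^sub>0 f"
      unfolding f_def v_def
      by (intro continuous_intros j(1)) (use \<theta>(1) continuous_on_subset in blast)
    show "\<eta> > 0" by fact
    fix u assume u: "u \<in> K\<^sub>0"
    show "j u + \<tau> *\<^sub>R f u \<in> K" if \<tau>: "\<tau> \<in> {0<..\<eta>}" for \<tau>
    proof -
      have "j u + (\<tau> / h i) *\<^sub>R (k i - j u) \<in> K" if i: "i \<in> I" for i
      proof -
        have "(1 - \<tau> / h i) *\<^sub>R j u + (\<tau> / h i) *\<^sub>R k i \<in> K"
          using \<tau> \<eta>(2)[OF i] h[OF IK[OF i]] k[OF IK[OF i]] u j(2) by (intro convexD[OF K]) (auto simp: divide_le_eq_1)
        then show ?thesis by (simp add: algebra_simps)
      qed
      then have "j u + (\<Sum>i\<in>I. \<theta> i u *\<^sub>R (j u + (\<tau> / h i) *\<^sub>R (k i - j u) - j u)) \<in> K"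
        using u j(2) \<theta>(2,4) by (intro convex_sum_le_1[OF K _ I(2)]) auto
      also have "(\<Sum>i\<in>I. \<theta> i u *\<^sub>R (j u + (\<tau> / h i) *\<^sub>R (k i - j u) - j u)) = \<tau> *\<^sub>R f u"
        unfolding f_def v_def scaleR_sum_right by (intro sum.cong) auto
      finally show ?thesis .
    qed
    have "0 \<le> M"
      using tangency[OF u] M[OF u] by (meson disjoint_iff norm_ge_zero order_trans)
    have "0 + (\<Sum>i\<in>I. \<theta> i u *\<^sub>R (v i u - 0)) \<in> cball 0 (M + \<epsilon>)"
    proof (rule convex_sum_le_1[OF convex_cball _ I(2)])
      fix i assume i: "i \<in> I" "\<theta> i u \<noteq> 0"
      have "norm (v i u) \<le> norm (w i) + dist (w i) (v i u)"
        by (metis dist_commute dist_norm norm_triangle_sub)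
      then show "v i u \<in> cball 0 (M + \<epsilon>)"
        using v_near[OF i(1) u i(2)] M[OF IK[OF i(1)] w[OF IK[OF i(1)]]] \<epsilon> by auto
    qed (use \<theta>(2,4) \<open>0 \<le> M\<close> \<epsilon> in auto)
    then show "norm (f u) \<le> M + \<epsilon>"
      by (simp add: f_def)
  next
    fix u assume u: "u \<in> Q"
    then have uK: "u \<in> K\<^sub>0" using Q(2) by blast
    \<comment> \<open>Of the balls that contain \<open>u\<close>, the largest one, doubled, contains the centres of all the others.
      Hence the values chosen at these centres are all close to the single convex set \<open>\<Phi> m\<close>, and so
      is their average.\<close>
    let ?act = "{i \<in> I. \<theta> i u \<noteq> 0}"
    have "?act \<noteq> {}"
      using \<theta>(5)[OF u] by (metis (mono_tags, lifting) empty_iff mem_Collect_eq sum.neutral zero_neq_one)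
    then have "Max (d ` ?act) \<in> d ` ?act"
      using I(2) by (intro Max_in) auto
    then obtain m where m: "m \<in> ?act" "d m = Max (d ` ?act)"
      by auto
    have d_le: "d i \<le> d m" if "i \<in> ?act" for i
      unfolding m(2) using that I(2) by (intro Max_ge) auto
    have mK: "m \<in> K\<^sub>0" using m(1) IK by blast
    let ?C = "\<Union>z\<in>\<Phi> m. \<Union>e\<in>cball 0 \<epsilon>. {z + e}"
    have inC: "y \<in> ?C" if "z \<in> \<Phi> m" "dist z y \<le> \<epsilon>" for y z
    proof -
      have "y - z \<in> cball 0 \<epsilon>" "y = z + (y - z)"
        using that(2) by (auto simp: dist_norm norm_minus_commute)
      then show ?thesis using that(1) by blast
    qed
    have "w m + (\<Sum>i\<in>I. \<theta> i u *\<^sub>R (v i u - w m)) \<in> ?C"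
    proof (rule convex_sum_le_1[OF _ _ I(2)])
      show "convex ?C"
        by (intro convex_sums convex_values[OF mK] convex_cball)
      show "w m \<in> ?C"
        using w[OF mK] \<epsilon> by (intro inC[of "w m"]) auto
      fix i assume i: "i \<in> I" "\<theta> i u \<noteq> 0"
      have "dist m i \<le> dist m u + dist i u"
        by (rule dist_triangle2)
      also have "\<dots> < 2 * d m"
        using \<theta>(3)[OF i(2)] \<theta>(3)[of m u] m(1) d_le[of i] i by simp
      finally have "\<Phi> i \<subseteq> {z. infdist z (\<Phi> m) < \<epsilon> / 2}"
        by (rule values_near[OF mK IK[OF i(1)]])
      then have "infdist (w i) (\<Phi> m) < \<epsilon> / 2"
        using w[OF IK[OF i(1)]] by blast
      then obtain z where z: "z \<in> \<Phi> m" "dist (w i) z < \<epsilon> / 2"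
        using infdist_lessE w[OF mK] by (metis empty_iff)
      have "dist z (v i u) \<le> dist (w i) z + dist (w i) (v i u)"
        by (rule dist_triangle3)
      then show "v i u \<in> ?C"
        using z v_near[OF i(1) uK i(2)] by (intro inC[OF z(1)]) auto
    qed (use \<theta>(2,4) in auto)
    also have "w m + (\<Sum>i\<in>I. \<theta> i u *\<^sub>R (v i u - w m)) = f u"
      using \<theta>(5)[OF u] by (simp add: f_def scaleR_diff_right sum_subtractf flip: scaleR_sum_left)
    finally obtain z e where "z \<in> \<Phi> m" "norm e \<le> \<epsilon>" "f u = z + e"
      by auto
    moreover have "dist m u < \<epsilon>"
      using \<theta>(3)[of m u] m(1) d(2)[OF mK] by auto
    ultimately show "\<exists>x\<in>K\<^sub>0. dist x u < \<epsilon> \<and> (\<exists>z\<in>\<Phi> x. dist z (f u) \<le> \<epsilon>)"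
      using mK by (intro bexI[of _ m] conjI bexI[of _ z]) (auto simp: dist_norm)
  qed
qed

section \<open>Resolvents\<close>

text \<open>Since \<open>I - h A = h (1 / h - A)\<close>, these facts are those of the resolvent at \<open>1 / h\<close>.\<close>

lemma
  fixes A :: "'a::real_normed_vector \<Rightarrow> 'a"
  assumes A: "linear_operator_on D A" and h: "h > 0" "1 / h \<in> real_resolvent_set D A"
  shows resolvent_op_bounded_linear: "bounded_linear (resolvent_op D A h)"
    and resolvent_op_in_domain: "resolvent_op D A h y \<in> D"
    and resolvent_op_right_inverse: "resolvent_op D A h y - h *\<^sub>R A (resolvent_op D A h y) = y"
    and resolvent_op_left_inverse: "u \<in> D \<Longrightarrow> resolvent_op D A h (u - h *\<^sub>R A u) = u"
proof -
  define g where "g u = (1 / h) *\<^sub>R u - A u" for u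
  have g: "bij_betw g D UNIV" "bounded_linear (inv_into D g)"
    using h(2) unfolding real_resolvent_set_def g_def by auto
  have hg: "u - h *\<^sub>R A u = h *\<^sub>R g u" for u
    using h(1) by (simp add: g_def scaleR_diff_right)
  have "bij_betw (\<lambda>y::'a. h *\<^sub>R y) UNIV UNIV"
    using h(1) by (intro bij_betwI[of _ _ _ "\<lambda>y. (1 / h) *\<^sub>R y"]) auto
  then have bij: "bij_betw (\<lambda>u. u - h *\<^sub>R A u) D UNIV"
    unfolding hg using bij_betw_trans[OF g(1), of "\<lambda>y. h *\<^sub>R y" UNIV] by (simp add: o_def)
  show dom: "resolvent_op D A h y \<in> D" for y
    unfolding resolvent_op_def using bij by (metis UNIV_I bij_betw_def inv_into_into)
  show right: "resolvent_op D A h y - h *\<^sub>R A (resolvent_op D A h y) = y" for y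
    unfolding resolvent_op_def using bij_betw_inv_into_right[OF bij] by simp
  show "resolvent_op D A h (u - h *\<^sub>R A u) = u" if "u \<in> D" for u
    unfolding resolvent_op_def using bij_betw_inv_into_left[OF bij that] by simp
  have "resolvent_op D A h y = inv_into D g ((1 / h) *\<^sub>R y)" for y
  proof -
    have "g (resolvent_op D A h y) = (1 / h) *\<^sub>R y"
      using right[of y] h(1) unfolding hg by (metis divide_inverse_commute mult.right_neutral
          nonzero_divide_eq_eq order_less_irrefl scaleR_one scaleR_scaleR)
    then show ?thesis
      using bij_betw_inv_into_left[OF g(1) dom[of y]] by simp
  qed
  then have "resolvent_op D A h = (\<lambda>y. inv_into D g ((1 / h) *\<^sub>R y))"
    by blast
  then show "bounded_linear (resolvent_op D A h)"
    by (simp add: bounded_linear_compose[OF g(2) bounded_linear_scaleR_right])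
qed

section \<open>Equilibria\<close>

theorem theorem3p4:
  fixes K :: "'a::banach set"
    and D :: "'a set" and A :: "'a \<Rightarrow> 'a" and \<omega> :: real
    and j :: "'b::banach \<Rightarrow> 'a" and K\<^sub>0 :: "'b set"
    and \<Phi> :: "'b \<Rightarrow> 'a set"
  assumes K: "K \<noteq> {}" "bounded K" "closed K" "convex K"
    and A: "linear_operator_on D A" "closure D = UNIV"
    and resolvent: "{\<omega><..} \<subseteq> real_resolvent_set D A"
    and K0: "closed K\<^sub>0" "convex K\<^sub>0" "j ` K\<^sub>0 \<subseteq> K"
    and j: "bounded_linear j" "inj j"
    and D_E0: "D \<subseteq> range j" "continuous_in_graph_norm D A (inv j)"
    and \<Phi>_usc: "H_usc_on K\<^sub>0 \<Phi>"
    and \<Phi>_bounded: "bounded (\<Union>u\<in>K\<^sub>0. \<Phi> u)"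
    and \<Phi>_values: "\<And>u. u \<in> K\<^sub>0 \<Longrightarrow> convex (\<Phi> u) \<and> compactin weak_topology (\<Phi> u)"
    and tangency: "\<And>u. u \<in> K\<^sub>0 \<Longrightarrow> \<Phi> u \<inter> contingent_cone K (j u) \<noteq> {}"
    and resolvent_K: "\<forall>\<^sub>F h in at_right 0. resolvent_op D A h ` K \<subseteq> j ` K\<^sub>0 \<and>
          compact_map (\<lambda>y. inv j (resolvent_op D A h y))"
  shows "\<exists>u\<in>K\<^sub>0. j u \<in> D \<and> 0 \<in> (\<lambda>w. A (j u) + w) ` \<Phi> u"
proof -
  define J where "J = resolvent_op D A"
  define G where "G h y = inv j (J h y)" for h y
  define good where "good h \<longleftrightarrow> 0 < h \<and> 1 / h \<in> real_resolvent_set D A \<and>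
    J h ` K \<subseteq> j ` K\<^sub>0 \<and> compact_map (G h)" for h
  have "\<forall>\<^sub>F h in at_right 0. \<omega> < 1 / h"
    using filterlim_inverse_at_top_right[unfolded filterlim_at_top_dense]
    by (simp add: inverse_eq_divide)
  then have ev_good: "\<forall>\<^sub>F h in at_right 0. good h"
    using resolvent_K eventually_at_right_less[of "0::real"] unfolding good_def G_def J_def
    by eventually_elim (use resolvent in auto)
  have J_lin: "bounded_linear (J h)" and J_dom: "J h y \<in> D"
    and J_right: "J h y - h *\<^sub>R A (J h y) = y" and J_left: "u \<in> D \<Longrightarrow> J h (u - h *\<^sub>R A u) = u"
    if "good h" for h y u
    using that resolvent_op_bounded_linear[OF A(1)] resolvent_op_in_domain[OF A(1)]
      resolvent_op_right_inverse[OF A(1)] resolvent_op_left_inverse[OF A(1)]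
    unfolding good_def J_def by blast+
  have jG: "j (G h y) = J h y" if "good h" for h y
    unfolding G_def using J_dom[OF that] D_E0(1) by (intro f_inv_into_f) blast
  have inv_j: "inv j (j u) = u" for u
    using j(2) by simp
  have G_lin: "linear (G h)" if "good h" for h
  proof (rule linearI)
    interpret J: bounded_linear "J h" by (rule J_lin[OF that])
    interpret j: bounded_linear j by (rule j(1))
    show "G h (x + y) = G h x + G h y" for x y
      by (rule injD[OF j(2)]) (simp add: jG[OF that] J.add j.add)
    show "G h (c *\<^sub>R x) = c *\<^sub>R G h x" for c x
      by (rule injD[OF j(2)]) (simp add: jG[OF that] J.scaleR j.scaleR)
  qed
  have j_cont: "continuous_on X j" for X
    using j(1) by (rule linear_continuous_on)
  obtain N where N: "\<And>y. y \<in> K \<Longrightarrow> norm y \<le> N"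
    using K(2) unfolding bounded_iff by blast
  obtain M where M: "\<And>u w. u \<in> K\<^sub>0 \<Longrightarrow> w \<in> \<Phi> u \<Longrightarrow> norm w \<le> M"
    using \<Phi>_bounded unfolding bounded_iff by blast
  obtain h0 where h0: "good h0"
    using eventually_happens[OF ev_good] by (auto simp: trivial_limit_at_right_real)
  then have h0_pos: "h0 > 0" by (simp add: good_def)
  \<comment> \<open>A compact set that contains all approximate solutions: if \<open>norm (A (j u)) \<le> M + 1\<close>, then
    \<open>u = G h0 (j u - h0 A (j u))\<close> is the image of a point of this ball. It is fixed before \<open>h\<close> is
    chosen, because the admissible step lengths depend on it.\<close>
  define Q where "Q = closure (G h0 ` cball 0 (N + h0 * (M + 1))) \<inter> K\<^sub>0"
  have "compact (closure (G h0 ` cball 0 (N + h0 * (M + 1))))"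
    using h0 unfolding good_def compact_map_def by blast
  then have Q: "compact Q" "Q \<subseteq> K\<^sub>0"
    unfolding Q_def by (auto intro: compact_Int_closed K0(1))
  have \<Phi>_convex: "\<And>u. u \<in> K\<^sub>0 \<Longrightarrow> convex (\<Phi> u)"
    using \<Phi>_values by blast
  have approx: "\<exists>u\<in>Q. j u \<in> D \<and> (\<exists>x\<in>K\<^sub>0. dist x u < \<epsilon> \<and> (\<exists>z\<in>\<Phi> x. dist z (- A (j u)) \<le> \<epsilon>))"
    if \<epsilon>: "0 < \<epsilon>" "\<epsilon> \<le> 1" for \<epsilon>
  proof -
    have "\<exists>f \<eta>. continuous_on K\<^sub>0 f \<and> \<eta> > 0 \<and>
        (\<forall>u\<in>K\<^sub>0. \<forall>h\<in>{0<..\<eta>}. j u + h *\<^sub>R f u \<in> K) \<and>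
        (\<forall>u\<in>K\<^sub>0. norm (f u) \<le> M + \<epsilon>) \<and>
        (\<forall>u\<in>Q. \<exists>x\<in>K\<^sub>0. dist x u < \<epsilon> \<and> (\<exists>z\<in>\<Phi> x. dist z (f u) \<le> \<epsilon>))"
      by (rule tangent_graph_approximation)
        (fact K(4) j_cont K0(3) \<Phi>_usc \<Phi>_convex tangency M Q \<epsilon>(1))+
    then obtain f \<eta> where f: "continuous_on K\<^sub>0 f" "\<eta> > (0::real)"
      "\<And>u h. u \<in> K\<^sub>0 \<Longrightarrow> h \<in> {0<..\<eta>} \<Longrightarrow> j u + h *\<^sub>R f u \<in> K"
      "\<And>u. u \<in> K\<^sub>0 \<Longrightarrow> norm (f u) \<le> M + \<epsilon>"
      "\<And>u. u \<in> Q \<Longrightarrow> \<exists>x\<in>K\<^sub>0. dist x u < \<epsilon> \<and> (\<exists>z\<in>\<Phi> x. dist z (f u) \<le> \<epsilon>)"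
      by metis
    have "\<forall>\<^sub>F h in at_right 0. h < \<eta>"
      using f(2) by (rule order_tendstoD(2)[OF tendsto_ident_at])
    from eventually_happens[OF eventually_conj[OF ev_good this]]
    obtain h where h: "good h" "h < \<eta>"
      by (auto simp: trivial_limit_at_right_real)
    then have h_pos: "h > 0" by (simp add: good_def)
    \<comment> \<open>The implicit Euler map \<open>F\<close> sends \<open>S\<close> into itself: the explicit step \<open>j u + h f u\<close> stays in \<open>K\<close>, and
      the resolvent maps \<open>K\<close> into \<open>S\<close>. Its fixed points are the zeros of \<open>A + f\<close>.\<close>
    define S where "S = closure (G h ` K)"
    have GK: "G h y \<in> K\<^sub>0" if "y \<in> K" for y
      using h(1) that inv_j unfolding good_def G_def by fastforce
    have S: "compact S" "convex S" "S \<noteq> {}" "S \<subseteq> K\<^sub>0"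
    proof -
      show "compact S"
        using h(1) K(2) unfolding S_def good_def compact_map_def by blast
      show "convex S"
        unfolding S_def by (intro convex_closure convex_linear_image G_lin h K)
      show "S \<noteq> {}"
        using K(1) unfolding S_def by simp
      show "S \<subseteq> K\<^sub>0"
        unfolding S_def using GK by (intro closure_minimal K0) auto
    qed
    define F where "F u = G h (j u + h *\<^sub>R f u)" for u
    have "continuous_on S F"
      unfolding F_def
    proof (rule continuous_on_compose2[where g = "G h" and t = UNIV])
      show "continuous_on UNIV (G h)"
        using h(1) unfolding good_def compact_map_def by blast
      show "continuous_on S (\<lambda>u. j u + h *\<^sub>R f u)"
        by (intro continuous_intros j_cont continuous_on_subset[OF f(1) S(4)])
    qed simp
    moreover have "F \<in> S \<rightarrow> S"
      using f(3) h(2) h_pos S(4) closure_subset unfolding F_def S_def by fastforce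
    ultimately obtain u where u: "u \<in> S" "F u = u"
      using schauder_fixed_point[OF S(1-3)] by blast
    have uK: "u \<in> K\<^sub>0" using u(1) S(4) by blast
    have ju: "j u = J h (j u + h *\<^sub>R f u)"
      using jG[OF h(1)] u(2) unfolding F_def by metis
    then have uD: "j u \<in> D"
      using J_dom[OF h(1)] by metis
    have "j u - h *\<^sub>R A (j u) = j u + h *\<^sub>R f u"
      using J_right[OF h(1)] ju by metis
    then have Af: "- A (j u) = f u"
      using h_pos by (metis add_left_cancel diff_conv_add_uminus less_irrefl scaleR_left_imp_eq scaleR_minus_right)
    have "G h0 (j u + h0 *\<^sub>R f u) = u"
      using J_left[OF h0 uD] inv_j[of u] by (simp add: G_def flip: Af)
    moreover have "j u + h0 *\<^sub>R f u \<in> cball 0 (N + h0 * (M + 1))"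
    proof -
      have "norm (j u + h0 *\<^sub>R f u) \<le> norm (j u) + h0 * norm (f u)"
        using h0_pos norm_triangle_ineq[of "j u" "h0 *\<^sub>R f u"] by simp
      also have "\<dots> \<le> N + h0 * (M + 1)"
        using N K0(3) uK f(4)[OF uK] \<epsilon>(2) h0_pos by (intro add_mono mult_left_mono) auto
      finally show ?thesis by simp
    qed
    ultimately have "u \<in> Q"
      unfolding Q_def using uK closure_subset by (metis IntI image_eqI subsetD)
    then show ?thesis
      using uD f(5) Af by metis
  qed
  have "\<exists>u x z. u \<in> Q \<and> j u \<in> D \<and> x \<in> K\<^sub>0 \<and> dist x u < inverse (real (Suc n)) \<and> z \<in> \<Phi> x \<and>
      dist z (- A (j u)) \<le> inverse (real (Suc n))" for n
    using approx[of "inverse (real (Suc n))"] by (auto simp: inverse_le_1_iff)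
  then obtain u x z where u: "\<And>n. u n \<in> Q" "\<And>n. j (u n) \<in> D" and x: "\<And>n. x n \<in> K\<^sub>0"
    "\<And>n. dist (x n) (u n) < inverse (real (Suc n))" and z: "\<And>n. z n \<in> \<Phi> (x n)"
    "\<And>n. dist (z n) (- A (j (u n))) \<le> inverse (real (Suc n))"
    by metis
  obtain v \<phi> where v: "v \<in> Q" and \<phi>: "strict_mono (\<phi> :: nat \<Rightarrow> nat)" and lim: "(u \<circ> \<phi>) \<longlonglongrightarrow> v"
    using seq_compactE[OF compact_imp_seq_compact[OF Q(1)]] u(1) by metis
  have vK: "v \<in> K\<^sub>0" using v Q(2) by blast
  have inv0: "(\<lambda>n. inverse (real (Suc (\<phi> n)))) \<longlonglongrightarrow> 0"
    using LIMSEQ_subseq_LIMSEQ[OF LIMSEQ_inverse_real_of_nat \<phi>] by (simp add: o_def)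
  have limu: "(\<lambda>n. u (\<phi> n)) \<longlonglongrightarrow> v" using lim by (simp add: o_def)
  have "(\<lambda>n. x (\<phi> n) - u (\<phi> n)) \<longlonglongrightarrow> 0"
    by (rule Lim_null_comparison[OF _ inv0]) (use x(2) in \<open>auto simp: dist_norm intro!: always_eventually less_imp_le\<close>)
  from tendsto_add[OF this limu] have limx: "(\<lambda>n. x (\<phi> n)) \<longlonglongrightarrow> v" by simp
  \<comment> \<open>By upper semicontinuity \<open>- A (j (u n))\<close> is close to \<open>\<Phi> v\<close>. Instead of a limit of these vectors,
    the resolvent identity \<open>j u - J h0 (j u) = h0 J h0 (- A (j u))\<close> is used, whose left-hand side
    converges in norm.\<close>
  have near: "\<exists>w\<in>\<Phi> v. dist (j v - J h0 (j v)) (h0 *\<^sub>R J h0 w) < \<epsilon>" if \<epsilon>: "\<epsilon> > 0" for \<epsilon>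
  proof -
    interpret J: bounded_linear "J h0" by (rule J_lin[OF h0])
    obtain C where C: "C > 0" "\<And>y. norm (J h0 y) \<le> norm y * C"
      using J.pos_bounded by blast
    \<comment> \<open>An error of \<open>2 \<kappa>\<close> becomes \<open>\<epsilon> / 2\<close> under \<open>h0 J h0\<close>.\<close>
    define \<kappa> where "\<kappa> = \<epsilon> / (4 * h0 * C)"
    have \<kappa>: "\<kappa> > 0" using \<epsilon> h0_pos C(1) by (simp add: \<kappa>_def)
    obtain \<delta> where \<delta>: "\<delta> > 0" "\<And>y. y \<in> K\<^sub>0 \<Longrightarrow> norm (y - v) < \<delta> \<Longrightarrow> \<Phi> y \<subseteq> {z. infdist z (\<Phi> v) < \<kappa>}"
      using \<Phi>_usc vK \<kappa> unfolding H_usc_on_def by meson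
    have "isCont (\<lambda>y. j y - J h0 (j y)) v"
      using j(1) J_lin[OF h0] by (intro continuous_intros linear_continuous_at bounded_linear_compose[OF J_lin[OF h0] j(1)])
    from isCont_tendsto_compose[OF this limu]
    have "\<forall>\<^sub>F n in sequentially. dist (j (u (\<phi> n)) - J h0 (j (u (\<phi> n)))) (j v - J h0 (j v)) < \<epsilon> / 2"
      using half_gt_zero[OF \<epsilon>] by (rule tendstoD)
    moreover have "\<forall>\<^sub>F n in sequentially. dist (x (\<phi> n)) v < \<delta>"
      using limx \<delta>(1) by (rule tendstoD)
    moreover have "\<forall>\<^sub>F n in sequentially. inverse (real (Suc (\<phi> n))) < \<kappa>"
      using inv0 \<kappa> by (rule order_tendstoD(2))
    ultimately have "\<forall>\<^sub>F n in sequentially. dist (j (u (\<phi> n)) - J h0 (j (u (\<phi> n)))) (j v - J h0 (j v)) < \<epsilon> / 2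
        \<and> dist (x (\<phi> n)) v < \<delta> \<and> inverse (real (Suc (\<phi> n))) < \<kappa>"
      by eventually_elim blast
    then obtain m where m: "dist (j (u m) - J h0 (j (u m))) (j v - J h0 (j v)) < \<epsilon> / 2"
      "dist (x m) v < \<delta>" "inverse (real (Suc m)) < \<kappa>"
      using eventually_happens'[OF sequentially_bot] by blast
    have "infdist (z m) (\<Phi> v) < \<kappa>"
      using \<delta>(2)[OF x(1)[of m]] m(2) z(1)[of m] by (auto simp: dist_norm)
    then obtain w where w: "w \<in> \<Phi> v" "dist (z m) w < \<kappa>"
      using infdist_lessE tangency[OF vK] by blast
    let ?e = "- A (j (u m))"
    have "dist ?e w \<le> dist (z m) ?e + dist (z m) w"
      by (rule dist_triangle3)
    then have ew: "norm (?e - w) \<le> 2 * \<kappa>"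
      using z(2)[of m] m(3) w(2) by (simp add: dist_norm)
    have "J h0 (j (u m) + h0 *\<^sub>R ?e) = j (u m)"
      using J_left[OF h0 u(2)[of m]] by simp
    then have "j (u m) - J h0 (j (u m)) - h0 *\<^sub>R J h0 w = h0 *\<^sub>R J h0 (?e - w)"
      by (simp add: J.add J.diff J.neg J.scaleR algebra_simps)
    then have "dist (j (u m) - J h0 (j (u m))) (h0 *\<^sub>R J h0 w) = h0 * norm (J h0 (?e - w))"
      using h0_pos by (simp add: dist_norm)
    also have "\<dots> \<le> h0 * (2 * \<kappa> * C)"
      using h0_pos C(1) ew by (intro mult_left_mono order_trans[OF C(2)] mult_right_mono) auto
    also have "\<dots> = \<epsilon> / 2"
      using h0_pos C(1) by (simp add: \<kappa>_def)
    finally have "dist (j v - J h0 (j v)) (h0 *\<^sub>R J h0 w) < \<epsilon>"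
      using m(1) dist_triangle3[of "j v - J h0 (j v)" "h0 *\<^sub>R J h0 w" "j (u m) - J h0 (j (u m))"] by linarith
    then show ?thesis using w(1) by blast
  qed
  have "bounded_linear (\<lambda>w. h0 *\<^sub>R J h0 w)"
    by (intro bounded_linear_compose[OF bounded_linear_scaleR_right J_lin] h0)
  then have "closed ((\<lambda>w. h0 *\<^sub>R J h0 w) ` \<Phi> v)"
    using \<Phi>_values[OF vK] by (intro closed_image_weakly_compact) auto
  moreover have "j v - J h0 (j v) \<in> closure ((\<lambda>w. h0 *\<^sub>R J h0 w) ` \<Phi> v)"
    unfolding closure_approachable using near by (auto simp: dist_commute)
  ultimately obtain w where w: "w \<in> \<Phi> v" "j v - J h0 (j v) = h0 *\<^sub>R J h0 w"
    by (auto simp: closure_closed)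
  interpret J: bounded_linear "J h0" by (rule J_lin[OF h0])
  have jv: "j v = J h0 (j v + h0 *\<^sub>R w)"
    using w(2) by (simp add: J.add J.scaleR algebra_simps)
  then have "j v \<in> D"
    using J_dom[OF h0] by metis
  moreover have "j v - h0 *\<^sub>R A (j v) = j v + h0 *\<^sub>R w"
    using J_right[OF h0] jv by metis
  then have "h0 *\<^sub>R (A (j v) + w) = 0"
    by (simp add: algebra_simps)
  then have "0 = A (j v) + w"
    using h0_pos by simp
  ultimately show ?thesis
    using vK w(1) by blast
qed

end
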